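(* Let $0\le k\le d$ be integers, and let $\mathcal{F}_1,\dots,\mathcal{F}_{d-k+1}$ be finite families of closed convex sets in $\mathbb{R}^d$. Suppose that for every choice of $F_1\in\mathcal{F}_1,\dots,F_{d-k+1}\in\mathcal{F}_{d-k+1}$ the intersection $\bigcap_{i=1}^{d-k+1}F_i$ contains a $k$-flat. Then there is some $i\in\{1,\dots,d-k+1\}$ such that $\bigcap\mathcal{F}_i$ contains a $k$-flat.
   Context: A $k$-flat in $\mathbb{R}^d$ is a $k$-dimensional affine subspace (a $0$-flat is a point). $\bigcap\mathcal{F}$ denotes the intersection of all sets in the family $\mathcal{F}$; the intersection of an empty family is taken to be $\mathbb{R}^d$. *)

theory Defs
  imports "HOL-Analysis.Analysis"
begin

text \<open>
  The ambient space \<open>\<real>\<^sup>d\<close> is rendered as a \<open>d\<close>-dimensional linear subspace \<open>V\<close> of a type of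
  class \<open>euclidean_space\<close>: \<open>V = UNIV\<close> gives the spaces \<open>real ^ 'n\<close>, and \<open>V = {0}\<close> gives
  \<open>\<real>\<^sup>0\<close>, which is not a \<open>euclidean_space\<close> type because \<open>DIM('a) > 0\<close>. As \<open>V\<close> is closed, a
  subset of \<open>V\<close> is closed in \<open>V\<close> iff it is \<open>closed\<close>.
\<close>

definition flat :: "nat \<Rightarrow> 'a::euclidean_space set \<Rightarrow> bool" where
  "flat k L \<longleftrightarrow> affine L \<and> aff_dim L = int k"

definition contains_flat :: "nat \<Rightarrow> 'a::euclidean_space set \<Rightarrow> bool" where
  "contains_flat k S \<longleftrightarrow> (\<exists>L. flat k L \<and> L \<subseteq> S)"

text \<open>Intersecting with \<open>V\<close> makes the intersection of the empty family the ambient space.\<close>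

definition inter_within :: "'a set \<Rightarrow> 'a set set \<Rightarrow> 'a set" where
  "inter_within V \<F> = V \<inter> \<Inter> \<F>"

end

theory Submission
  imports Defs
begin

text \<open>
  A closed convex set contains a \<open>k\<close>-flat iff it is nonempty and its lineality space has dimension
  at least \<open>k\<close>. A dual form of Rado's transversal theorem, applied to the lineality spaces, yields
  a nonempty set \<open>J\<close> of indices such that the common lineality space \<open>M\<close> of all members of the
  families in \<open>J\<close> has codimension less than \<open>card J\<close>. Modulo \<open>M\<close>, the colourful Helly theorem
  applies to the families in \<open>J\<close> and gives a family with nonempty intersection; that
  intersection is invariant under translation by \<open>M\<close>, and \<open>dim M \<ge> k\<close>.
\<close>

section \<open>Transversals of families of subspaces\<close>

text \<open>
  The proof follows Halmos and Vaughan: if some proper nonempty subset \<open>J\<close> of the indices is tight,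
  treat \<open>J\<close> and then \<open>I - J\<close>; otherwise an arbitrary choice for one index costs one dimension.
\<close>

lemma subspace_transversal:
  fixes T :: "'a::euclidean_space set" and \<M> :: "'i \<Rightarrow> 'a set set"
  assumes "finite I" "subspace T" "\<And>i A. i \<in> I \<Longrightarrow> A \<in> \<M> i \<Longrightarrow> subspace A"
    and "\<And>J. J \<subseteq> I \<Longrightarrow> dim (T \<inter> (\<Inter>i\<in>J. \<Inter>(\<M> i))) + card J \<le> dim T"
  shows "\<exists>f. (\<forall>i\<in>I. f i \<in> \<M> i) \<and> dim (T \<inter> (\<Inter>i\<in>I. f i)) + card I \<le> dim T"
  using assms
proof (induction "card I" arbitrary: I T rule: less_induct)
  case less
  note fin = less.prems(1) and T = less.prems(2) and sub = less.prems(3) and cond = less.prems(4)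
  show ?case
  proof (cases "I = {}")
    case True
    then show ?thesis by simp
  next
    case False
    show ?thesis
    proof (cases "\<exists>J. J \<subset> I \<and> J \<noteq> {} \<and> dim (T \<inter> (\<Inter>i\<in>J. \<Inter>(\<M> i))) + card J = dim T")
      case True
      then obtain J where J: "J \<subset> I" "J \<noteq> {}"
        and tight: "dim (T \<inter> (\<Inter>i\<in>J. \<Inter>(\<M> i))) + card J = dim T" by blast
      have finJ: "finite J" using J fin finite_subset by blast
      let ?T = "T \<inter> (\<Inter>i\<in>J. \<Inter>(\<M> i))"
      have subT: "subspace ?T"
        using J sub by (intro subspace_inter T subspace_Inter) (auto intro!: subspace_Inter)
      have "\<exists>f. (\<forall>i\<in>J. f i \<in> \<M> i) \<and> dim (T \<inter> (\<Inter>i\<in>J. f i)) + card J \<le> dim T"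
        using J by (intro less.hyps psubset_card_mono fin finJ T sub cond) auto
      then obtain f where f: "\<forall>i\<in>J. f i \<in> \<M> i" "dim (T \<inter> (\<Inter>i\<in>J. f i)) + card J \<le> dim T"
        by blast
      have subf: "subspace (T \<inter> (\<Inter>i\<in>J. f i))"
        using J sub f by (intro subspace_inter T subspace_Inter) auto
      \<comment> \<open>The right side contains the left, and tightness forces the dimensions to
        agree. So any admissible choice on \<open>J\<close> cuts out the whole of \<open>?T\<close>,
        and nothing is lost by fixing it before treating \<open>I - J\<close>.\<close>
      have eq: "?T = T \<inter> (\<Inter>i\<in>J. f i)"
        by (rule subspace_dim_equal[OF subT subf]) (use f tight in auto)
      \<comment> \<open>The dimension condition for \<open>J \<union> K\<close> minus the tight
        equality for \<open>J\<close> is the condition for \<open>K\<close> inside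
        \<open>?T\<close>.\<close>
      have cond': "dim (?T \<inter> (\<Inter>i\<in>K. \<Inter>(\<M> i))) + card K \<le> dim ?T" if K: "K \<subseteq> I - J" for K
      proof -
        have "card (J \<union> K) = card J + card K"
          using K fin finJ by (intro card_Un_disjoint) (auto intro: finite_subset)
        moreover have "T \<inter> (\<Inter>i\<in>J \<union> K. \<Inter>(\<M> i)) = ?T \<inter> (\<Inter>i\<in>K. \<Inter>(\<M> i))" by auto
        moreover have "J \<union> K \<subseteq> I" using J K by blast
        ultimately show ?thesis using cond[of "J \<union> K"] tight by simp
      qed
      have "\<exists>g. (\<forall>i\<in>I - J. g i \<in> \<M> i) \<and> dim (?T \<inter> (\<Inter>i\<in>I - J. g i)) + card (I - J) \<le> dim ?T"
        using J by (intro less.hyps psubset_card_mono fin subT sub cond') (auto simp: fin)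
      then obtain g where g: "\<forall>i\<in>I - J. g i \<in> \<M> i"
        "dim (?T \<inter> (\<Inter>i\<in>I - J. g i)) + card (I - J) \<le> dim ?T" by blast
      let ?h = "\<lambda>i. if i \<in> J then f i else g i"
      have "T \<inter> (\<Inter>i\<in>I. ?h i) = ?T \<inter> (\<Inter>i\<in>I - J. g i)"
        unfolding eq using J by (auto split: if_splits)
      moreover have "card I = card J + card (I - J)"
        using J finJ fin by (metis card_Diff_subset card_mono le_add_diff_inverse psubset_imp_subset)
      ultimately have "dim (T \<inter> (\<Inter>i\<in>I. ?h i)) + card I \<le> dim T"
        using g(2) tight by simp
      then show ?thesis using f(1) g(1) by (intro exI[of _ ?h]) auto
    next
      case no_tight: False
      obtain i where i: "i \<in> I" using False by blast
      have "dim (T \<inter> \<Inter>(\<M> i)) < dim T" using cond[of "{i}"] i by simp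
      then have "\<not> T \<subseteq> \<Inter>(\<M> i)" by (metis inf.absorb1 less_irrefl)
      then obtain A where A: "A \<in> \<M> i" "\<not> T \<subseteq> A" by blast
      have subA: "subspace (T \<inter> A)" using T sub i A by (simp add: subspace_inter)
      have "span (T \<inter> A) \<subset> span T"
        using A subA T by (metis Int_lower1 inf.orderI inf_commute psubsetI span_eq_iff)
      then obtain v where v: "v \<noteq> 0" "v \<in> span T" "\<And>y. y \<in> span (T \<inter> A) \<Longrightarrow> orthogonal v y"
        using orthogonal_to_subspace_exists_gen by blast
      \<comment> \<open>A hyperplane of \<open>T\<close> containing \<open>T \<inter> A\<close>:
        enlarging \<open>T \<inter> A\<close> to it makes the dimension drop exactly one, matching
        the one index removed.\<close>
      let ?T = "{y \<in> T. \<forall>x\<in>span {v}. orthogonal x y}"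
      have vT: "span {v} \<subseteq> T" using v T by (metis empty_subsetI insert_subset span_eq_iff span_minimal)
      have dimT: "dim ?T + 1 = dim T"
        using dim_subspace_orthogonal_to_vectors[OF subspace_span T vT] v(1) by simp
      have subT: "subspace ?T"
        using subspace_inter[OF T subspace_orthogonal_to_vectors[of "span {v}"]]
        by (simp add: Int_def)
      have AT: "T \<inter> A \<subseteq> ?T"
        using v(3) by (auto simp: span_singleton orthogonal_clauses span_base)
      have cond': "dim (?T \<inter> (\<Inter>i\<in>K. \<Inter>(\<M> i))) + card K \<le> dim ?T" if K: "K \<subseteq> I - {i}" for K
      proof (cases "K = {}")
        case False
        have "K \<subset> I" using K i by blast
        \<comment> \<open>Since \<open>K\<close> is nonempty, proper and not tight, its inequality
          is strict; this slack of one pays for passing to the hyperplane.\<close>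
        then have "dim (T \<inter> (\<Inter>i\<in>K. \<Inter>(\<M> i))) + card K < dim T"
          using no_tight False cond[of K] by (metis nat_less_le psubset_imp_subset)
        moreover have "dim (?T \<inter> (\<Inter>i\<in>K. \<Inter>(\<M> i))) \<le> dim (T \<inter> (\<Inter>i\<in>K. \<Inter>(\<M> i)))"
          by (intro dim_subset) auto
        ultimately show ?thesis using dimT by linarith
      qed simp
      have "\<exists>g. (\<forall>j\<in>I - {i}. g j \<in> \<M> j) \<and> dim (?T \<inter> (\<Inter>j\<in>I - {i}. g j)) + card (I - {i}) \<le> dim ?T"
        using i by (intro less.hyps psubset_card_mono fin subT sub cond') (auto simp: fin)
      then obtain g where g: "\<forall>j\<in>I - {i}. g j \<in> \<M> j"
        "dim (?T \<inter> (\<Inter>j\<in>I - {i}. g j)) + card (I - {i}) \<le> dim ?T" by blast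
      let ?h = "g(i := A)"
      have "T \<inter> (\<Inter>j\<in>I. ?h j) \<subseteq> ?T \<inter> (\<Inter>j\<in>I - {i}. g j)"
      proof -
        have "T \<inter> (\<Inter>j\<in>I. ?h j) \<subseteq> T \<inter> A" using i by (auto dest: bspec[of _ _ i])
        moreover have "T \<inter> (\<Inter>j\<in>I. ?h j) \<subseteq> (\<Inter>j\<in>I - {i}. g j)" by (auto split: if_splits)
        ultimately show ?thesis using AT by blast
      qed
      then have "dim (T \<inter> (\<Inter>j\<in>I. ?h j)) \<le> dim (?T \<inter> (\<Inter>j\<in>I - {i}. g j))"
        by (rule dim_subset)
      moreover have "card I = card (I - {i}) + 1"
        using card_Suc_Diff1[OF fin i] by simp
      ultimately have "dim (T \<inter> (\<Inter>j\<in>I. ?h j)) + card I \<le> dim T"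
        using g(2) dimT by linarith
      then show ?thesis using g(1) A(1) by (intro exI[of _ ?h]) auto
    qed
  qed
qed

section \<open>The colourful Helly theorem\<close>

text \<open>Radon's argument: pick a point in each intersection that omits one set. If two of these
  points coincide, that point lies in every set; otherwise they are at least
  \<open>dim W + 2\<close> distinct points of \<open>W\<close> and have a Radon partition. Indexing
  allows the same set to occur several times.\<close>

lemma Helly_indexed:
  fixes W :: "'a::euclidean_space set"
  assumes W: "subspace W" and fin: "finite J" and card: "card J \<ge> dim W + 2"
    and conv: "\<And>j. j \<in> J \<Longrightarrow> convex (C j)"
    and ne: "\<And>j. j \<in> J \<Longrightarrow> W \<inter> (\<Inter>l\<in>J - {j}. C l) \<noteq> {}"
  shows "W \<inter> (\<Inter>j\<in>J. C j) \<noteq> {}"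
proof -
  have "\<exists>x. \<forall>j\<in>J. x j \<in> W \<inter> (\<Inter>l\<in>J - {j}. C l)"
    using ne by (intro bchoice) blast
  then obtain x where x: "\<And>j. j \<in> J \<Longrightarrow> x j \<in> W"
    "\<And>j l. j \<in> J \<Longrightarrow> l \<in> J \<Longrightarrow> l \<noteq> j \<Longrightarrow> x j \<in> C l" by blast
  show ?thesis
  proof (cases "inj_on x J")
    case False
    then obtain a b where ab: "a \<in> J" "b \<in> J" "a \<noteq> b" "x a = x b" by (auto simp: inj_on_def)
    then have "x a \<in> W \<inter> (\<Inter>j\<in>J. C j)" using x by (metis IntI INT_I)
    then show ?thesis by blast
  next
    case True
    have xW: "x ` J \<subseteq> W" using x by blast
    then have "dim (x ` J) \<le> dim W" by (rule dim_subset)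
    then have "affine_dependent (x ` J)"
      using affine_dependent_biggerset_general[of "x ` J"] fin card card_image[OF True] by simp
    then obtain P Q where PQ: "P \<subseteq> x ` J" "Q \<subseteq> x ` J" "P \<inter> Q = {}"
      "convex hull P \<inter> convex hull Q \<noteq> {}" by (rule Radon)
    then obtain z where z: "z \<in> convex hull P" "z \<in> convex hull Q" by blast
    have hull: "convex hull R \<subseteq> C j" if "R \<subseteq> x ` J" "j \<in> J" "x j \<notin> R" for R j
    proof (rule hull_minimal)
      show "R \<subseteq> C j"
      proof
        fix y assume "y \<in> R"
        then obtain l where "l \<in> J" "y = x l" "l \<noteq> j" using \<open>R \<subseteq> x ` J\<close> \<open>x j \<notin> R\<close> by blast
        then show "y \<in> C j" using x(2) \<open>j \<in> J\<close> by blast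
      qed
    qed (use conv \<open>j \<in> J\<close> in auto)
    \<comment> \<open>The point \<open>x j\<close> is missing from \<open>P\<close> or from
      \<open>Q\<close>, and the hull of that part lies in \<open>C j\<close>.\<close>
    have "z \<in> C j" if "j \<in> J" for j
      using hull[OF PQ(1) that] hull[OF PQ(2) that] z PQ(3) by blast
    moreover have "z \<in> W"
      using hull_minimal[of P W convex] PQ(1) xW z(1) subspace_imp_convex[OF W] by blast
    ultimately show ?thesis by blast
  qed
qed

lemma closed_convex_Int_INT:
  fixes W :: "'a::euclidean_space set"
  assumes "subspace W" "\<And>j. j \<in> J \<Longrightarrow> closed (C j) \<and> convex (C j)"
  shows "closed (W \<inter> (\<Inter>j\<in>J. C j))" "convex (W \<inter> (\<Inter>j\<in>J. C j))"
  using assms by (simp_all add: closed_Int closed_INT closed_subspace convex_Int convex_INT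
      subspace_imp_convex)

text \<open>
  Among all choices omitting one family, take one whose intersection lies farthest from the origin.
  Helly's theorem, applied with an additional open ball, shows that adding a member of the omitted
  family cannot move the point of smallest norm.
\<close>

lemma colourful_Helly:
  fixes W :: "'a::euclidean_space set" and \<F> :: "'i \<Rightarrow> 'a set set"
  assumes W: "subspace W" and fin: "finite I" and card: "dim W < card I"
    and finF: "\<And>i. i \<in> I \<Longrightarrow> finite (\<F> i)"
    and cc: "\<And>i A. i \<in> I \<Longrightarrow> A \<in> \<F> i \<Longrightarrow> closed A \<and> convex A"
    and rainbow: "\<And>f. (\<And>i. i \<in> I \<Longrightarrow> f i \<in> \<F> i) \<Longrightarrow> W \<inter> (\<Inter>i\<in>I. f i) \<noteq> {}"
  shows "\<exists>i\<in>I. W \<inter> \<Inter>(\<F> i) \<noteq> {}"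
proof (cases "\<exists>i\<in>I. \<F> i = {}")
  case True
  then show ?thesis using subspace_0[OF W] by fastforce
next
  case False
  define \<phi> where "\<phi> i = (SOME A. A \<in> \<F> i)" for i
  have \<phi>: "\<phi> i \<in> \<F> i" if "i \<in> I" for i
    unfolding \<phi>_def using False that by (simp add: some_in_eq)
  define K where "K = (\<lambda>(i, f). W \<inter> (\<Inter>j\<in>I - {i}. f j))"
  \<comment> \<open>Extensional functions keep the set of partial choices finite, so that a maximum
    over it exists.\<close>
  define P where "P = (SIGMA i:I. PiE (I - {i}) \<F>)"
  define p where "p u = closest_point (K u) 0" for u
  have finP: "finite P"
    unfolding P_def using fin finF by (intro finite_SigmaI finite_PiE) auto
  have "I \<noteq> {}" using card by auto
  then obtain i0 where "i0 \<in> I" by blast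
  then have "(i0, restrict \<phi> (I - {i0})) \<in> P" unfolding P_def using \<phi> by auto
  then have neP: "P \<noteq> {}" by blast
  have "Max ((\<lambda>w. norm (p w)) ` P) \<in> (\<lambda>w. norm (p w)) ` P"
    using finP neP by (intro Max_in) auto
  then obtain u where uP: "u \<in> P" and "norm (p u) = Max ((\<lambda>w. norm (p w)) ` P)" by force
  then have umax: "norm (p w) \<le> norm (p u)" if "w \<in> P" for w
    using that finP by simp
  obtain i f where u_eq: "u = (i, f)" by fastforce
  have i: "i \<in> I" and f: "f \<in> PiE (I - {i}) \<F>" using uP u_eq unfolding P_def by auto
  have Kcc: "closed (K w)" "convex (K w)" if w: "w \<in> P" for w
  proof -
    obtain l g where lg: "w = (l, g)" by fastforce
    have g: "closed (g j) \<and> convex (g j)" if "j \<in> I - {l}" for j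
      using that w lg cc[of j "g j"] unfolding P_def by auto
    show "closed (K w)" "convex (K w)"
      unfolding lg K_def case_prod_conv
      by (rule closed_convex_Int_INT[OF W g]; assumption)
        (rule closed_convex_Int_INT[OF W g]; assumption)
  qed
  have "p u \<in> A" if A: "A \<in> \<F> i" for A
  proof -
    define h where "h = f(i := A)"
    define D where "D = W \<inter> (\<Inter>j\<in>I. h j)"
    have f': "h j \<in> \<F> j" if "j \<in> I" for j using f A that unfolding h_def by auto
    have D: "closed D" "D \<noteq> {}"
      unfolding D_def by (rule closed_convex_Int_INT[OF W] rainbow cc f' | assumption)+
    define q where "q = closest_point D 0"
    have qD: "q \<in> D" unfolding q_def by (rule closest_point_in_set) (use D in auto)
    have qK: "q \<in> K u" using qD unfolding D_def K_def u_eq h_def by (auto split: if_splits)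
    have qA: "q \<in> A" using qD i unfolding D_def h_def by (auto dest: bspec[of _ _ i])
    have "norm q \<le> norm (p u)"
    proof (rule ccontr)
      assume *: "\<not> norm q \<le> norm (p u)"
      \<comment> \<open>The index \<open>None\<close> carries the ball. Together with the sets
        \<open>h j\<close> this makes \<open>card I + 1 \<ge> dim W + 2\<close> sets, as many as
        Helly's theorem needs. A common point would lie in \<open>D\<close> and be strictly closer
        to the origin than \<open>q\<close>.\<close>
      define C where "C = case_option (ball 0 (norm q)) h"
      have C: "C None = ball 0 (norm q)" "\<And>j. C (Some j) = h j" unfolding C_def by simp_all
      let ?J = "insert None (Some ` I)"
      have "W \<inter> (\<Inter>j\<in>?J. C j) \<noteq> {}"
      proof (rule Helly_indexed[OF W])
        show "finite ?J" using fin by simp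
        have "card ?J = card I + 1"
          using fin by (subst card_insert_disjoint) (auto simp: card_image)
        then show "dim W + 2 \<le> card ?J" using card by simp
        show "convex (C j)" if "j \<in> ?J" for j
          using that cc f' by (auto simp: C)
        show "W \<inter> (\<Inter>l\<in>?J - {j}. C l) \<noteq> {}" if j: "j \<in> ?J" for j
        proof (cases j)
          case None
          \<comment> \<open>Without the ball, \<open>q\<close> itself is a common point; without
            \<open>h l\<close>, the nearest point of the remaining intersection serves, since by
            maximality of \<open>u\<close> its norm is at most that of \<open>p u\<close>, hence
            below that of \<open>q\<close>.\<close>
          then have "q \<in> W \<inter> (\<Inter>l\<in>?J - {j}. C l)" using qD unfolding D_def by (auto simp: C)
          then show ?thesis by blast
        next
          case (Some l)
          then have l: "l \<in> I" using j by auto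
          let ?w = "(l, restrict h (I - {l}))"
          have w: "?w \<in> P" unfolding P_def using l f' by auto
          have Kw: "K ?w = W \<inter> (\<Inter>j\<in>I - {l}. h j)" unfolding K_def by auto
          have "q \<in> K ?w" unfolding Kw using qD unfolding D_def by blast
          then have "p ?w \<in> K ?w"
            unfolding p_def using Kcc[OF w] by (intro closest_point_in_set) auto
          then have pW: "p ?w \<in> W" and pI: "\<And>j. j \<in> I \<Longrightarrow> j \<noteq> l \<Longrightarrow> p ?w \<in> h j"
            unfolding Kw by auto
          have "norm (p ?w) < norm q" using umax[OF w] * by linarith
          then have "p ?w \<in> C j'" if "j' \<in> ?J - {j}" for j'
            using that pI Some by (cases j') (auto simp: C)
          then show ?thesis using pW by blast
        qed
      qed
      then obtain z where "z \<in> W \<inter> (\<Inter>j\<in>?J. C j)" by blast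
      then have z: "z \<in> D" "norm z < norm q" unfolding D_def by (auto simp: C)
      then show False using closest_point_le[OF D(1) z(1), of 0] unfolding q_def by simp
    qed
    \<comment> \<open>Now \<open>q\<close> is a point of \<open>K u\<close> of least norm, and such
      a point is unique in a closed convex set.\<close>
    then have "\<forall>z\<in>K u. dist 0 q \<le> dist 0 z"
      using closest_point_le[OF Kcc(1)[OF uP], of _ 0] unfolding p_def by fastforce
    then have "q = p u"
      unfolding p_def by (intro closest_point_unique Kcc uP qK)
    then show ?thesis using qA by simp
  qed
  moreover have "p u \<in> W"
  proof -
    \<comment> \<open>Completing the partial choice by any member of the omitted family shows that
      \<open>K u\<close> is nonempty, so its nearest point really belongs to it.\<close>
    have "W \<inter> (\<Inter>j\<in>I. (f(i := \<phi> i)) j) \<noteq> {}"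
      using f \<phi> i by (intro rainbow) auto
    then have "K u \<noteq> {}" unfolding K_def u_eq by (auto split: if_splits)
    then have "p u \<in> K u" unfolding p_def using Kcc[OF uP] by (intro closest_point_in_set)
    then show ?thesis unfolding K_def u_eq by auto
  qed
  ultimately show ?thesis using i by blast
qed

section \<open>Lineality spaces\<close>

text \<open>Letting \<open>t\<close> range over all reals makes this a subspace for every set,
  convex or not.\<close>

definition lineality :: "'a::real_vector set \<Rightarrow> 'a set" where
  "lineality C = {v. \<forall>x\<in>C. \<forall>t. x + t *\<^sub>R v \<in> C}"

lemma subspace_lineality: "subspace (lineality C)"
proof (rule subspaceI)
  fix v w assume "v \<in> lineality C" "w \<in> lineality C"
  then have "(x + t *\<^sub>R v) + t *\<^sub>R w \<in> C" if "x \<in> C" for x t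
    using that unfolding lineality_def by blast
  then show "v + w \<in> lineality C"
    unfolding lineality_def by (simp add: scaleR_add_right add.assoc)
qed (auto simp: lineality_def)

lemma lineality_add: "v \<in> lineality C \<Longrightarrow> x \<in> C \<Longrightarrow> x + v \<in> C"
  unfolding lineality_def by (metis (mono_tags, lifting) mem_Collect_eq scaleR_one)

text \<open>Segments from \<open>x\<close> to ever more distant points of the line through
  \<open>a\<close> turn towards the direction \<open>v\<close>; points on them converge to
  \<open>x + t v\<close>, and closedness keeps the limit in \<open>C\<close>.\<close>

lemma line_direction_in_lineality:
  fixes C :: "'a::real_normed_vector set"
  assumes C: "closed C" "convex C" and line: "\<And>t. a + t *\<^sub>R v \<in> C"
  shows "v \<in> lineality C"
  unfolding lineality_def
proof (intro CollectI ballI allI)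
  fix x t assume x: "x \<in> C"
  define r where "r n = inverse (real (Suc n))" for n
  have "(\<lambda>n. (1 - r n) *\<^sub>R x + r n *\<^sub>R a + t *\<^sub>R v) \<longlonglongrightarrow> (1 - 0) *\<^sub>R x + 0 *\<^sub>R a + t *\<^sub>R v"
    unfolding r_def by (intro tendsto_intros LIMSEQ_inverse_real_of_nat)
  moreover have "(1 - r n) *\<^sub>R x + r n *\<^sub>R a + t *\<^sub>R v \<in> C" for n
  proof -
    \<comment> \<open>The parameter on the line grows like \<open>1 / r n\<close>, so that the
      weight \<open>r n\<close> leaves exactly the displacement \<open>t v\<close>.\<close>
    have "(1 - r n) *\<^sub>R x + r n *\<^sub>R (a + (t * real (Suc n)) *\<^sub>R v) \<in> C"
      using x line by (intro convexD C) (auto simp: r_def inverse_le_1_iff simp del: of_nat_Suc)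
    moreover have "r n * (t * real (Suc n)) = t" by (simp add: r_def field_simps del: of_nat_Suc)
    ultimately show ?thesis
      by (simp only: scaleR_add_right scaleR_scaleR add.assoc)
  qed
  ultimately show "x + t *\<^sub>R v \<in> C"
    using closed_sequentially[OF C(1)] by fastforce
qed

text \<open>The direction space of the flat has dimension \<open>k\<close>, and each of its vectors
  is the direction of a line in every \<open>C i\<close>.\<close>

lemma contains_flat_lineality:
  fixes V :: "'a::euclidean_space set"
  assumes V: "subspace V" and flat: "contains_flat k (V \<inter> (\<Inter>i\<in>I. C i))"
    and cc: "\<And>i. i \<in> I \<Longrightarrow> closed (C i) \<and> convex (C i)"
  shows "k \<le> dim (V \<inter> (\<Inter>i\<in>I. lineality (C i)))"
proof -
  obtain L where L: "affine L" "aff_dim L = int k" "L \<subseteq> V" "\<And>i. i \<in> I \<Longrightarrow> L \<subseteq> C i"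
    using flat unfolding contains_flat_def flat_def by blast
  then have "L \<noteq> {}" by auto
  then obtain a where a: "a \<in> L" by blast
  let ?D = "(\<lambda>x. x - a) ` L"
  have D: "subspace ?D" using affine_diffs_subspace_subtract[OF L(1) a] .
  have "int (dim ?D) = int k"
    using aff_dim_eq_dim_subtract[of a L] a L(2) by (simp add: hull_inc)
  moreover have "?D \<subseteq> V" using L(3) a V by (auto intro: subspace_diff)
  moreover have "v \<in> lineality (C i)" if "v \<in> ?D" "i \<in> I" for v i
  proof (rule line_direction_in_lineality[of _ a])
    show "a + t *\<^sub>R v \<in> C i" for t
    proof -
      have "t *\<^sub>R v \<in> ?D" using D that(1) by (rule subspace_scale)
      then show ?thesis using L(4)[OF that(2)] by auto
    qed
  qed (use cc that in auto)
  ultimately show ?thesis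
    using dim_subset[of ?D "V \<inter> (\<Inter>i\<in>I. lineality (C i))"] by auto
qed

text \<open>The flat is the translate by \<open>y\<close> of a subspace of \<open>M\<close> of
  dimension exactly \<open>k\<close>.\<close>

lemma contains_flat_translate:
  fixes M :: "'a::euclidean_space set"
  assumes M: "subspace M" "k \<le> dim M" and S: "\<And>v. v \<in> M \<Longrightarrow> y + v \<in> S"
  shows "contains_flat k S"
proof -
  obtain U where U: "subspace U" "U \<subseteq> span M" "dim U = k"
    using choose_subspace_of_subspace[OF M(2)] by blast
  have "flat k ((+) y ` U)"
    unfolding flat_def using U(1,3)
    by (simp add: aff_dim_translation_eq aff_dim_subspace subspace_imp_affine
        flip: affine_translation)
  moreover have "(+) y ` U \<subseteq> S" using S U(2) M(1) by (auto simp: span_eq_iff[THEN iffD2])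
  ultimately show ?thesis unfolding contains_flat_def by blast
qed

section \<open>Combining transversals of lineality spaces with the colourful Helly theorem\<close>

theorem theorem4:
  fixes V :: "'a::euclidean_space set"
    and \<F> :: "nat \<Rightarrow> 'a set set"
    and k d :: nat
  assumes "subspace V" and "dim V = d"
    and "k \<le> d"
    and "\<And>i. i \<in> {1..d - k + 1} \<Longrightarrow> finite (\<F> i)"
    and "\<And>i A. i \<in> {1..d - k + 1} \<Longrightarrow> A \<in> \<F> i \<Longrightarrow> A \<subseteq> V \<and> closed A \<and> convex A"
    and "\<And>F. (\<And>i. i \<in> {1..d - k + 1} \<Longrightarrow> F i \<in> \<F> i) \<Longrightarrow>
           contains_flat k (\<Inter>i\<in>{1..d - k + 1}. F i)"
  shows "\<exists>i\<in>{1..d - k + 1}. contains_flat k (inter_within V (\<F> i))"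
proof (cases "\<exists>i\<in>{1..d - k + 1}. \<F> i = {}")
  \<comment> \<open>Here no rainbow choice exists; the intersection of the empty family is
    \<open>V\<close>, which has dimension at least \<open>k\<close>.\<close>
  case True
  then obtain i where "i \<in> {1..d - k + 1}" "\<F> i = {}" by blast
  moreover have "contains_flat k V"
    using assms(1-3) by (intro contains_flat_translate[of V _ 0]) auto
  ultimately show ?thesis unfolding inter_within_def by (intro bexI[of _ i]) auto
next
  case False
  define I where "I = {1..d - k + 1}"
  note V = assms(1) and fin = assms(4)[folded I_def] and cc = assms(5)[folded I_def]
    and rainbow = assms(6)[folded I_def]
  have cardI: "card I = d - k + 1" and I: "finite I" "I \<noteq> {}" unfolding I_def by auto
  define \<phi> where "\<phi> i = (SOME A. A \<in> \<F> i)" for i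
  have \<phi>: "\<phi> i \<in> \<F> i" if "i \<in> I" for i
    unfolding \<phi>_def using False that by (simp add: some_in_eq I_def)
  define M where "M J = V \<inter> (\<Inter>i\<in>J. \<Inter>(lineality ` \<F> i))" for J
  have "\<exists>J\<subseteq>I. d < dim (M J) + card J"
  proof (rule ccontr)
    assume "\<not> (\<exists>J\<subseteq>I. d < dim (M J) + card J)"
    then have "dim (V \<inter> (\<Inter>i\<in>J. \<Inter>(lineality ` \<F> i))) + card J \<le> dim V" if "J \<subseteq> I" for J
      using that assms(2) unfolding M_def by (metis not_le)
    then obtain g where g: "\<And>i. i \<in> I \<Longrightarrow> g i \<in> lineality ` \<F> i"
      and dim_g: "dim (V \<inter> (\<Inter>i\<in>I. g i)) + card I \<le> dim V"
      using subspace_transversal[OF I(1) V, of "\<lambda>i. lineality ` \<F> i"] subspace_lineality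
      by (metis (no_types, lifting) imageE)
    have "\<forall>i\<in>I. \<exists>A. A \<in> \<F> i \<and> g i = lineality A" using g by blast
    then obtain f where f: "\<And>i. i \<in> I \<Longrightarrow> f i \<in> \<F> i" "\<And>i. i \<in> I \<Longrightarrow> g i = lineality (f i)"
      by metis
    have "(\<Inter>i\<in>I. f i) \<subseteq> V" using I(2) f(1) cc by blast
    then have "V \<inter> (\<Inter>i\<in>I. f i) = (\<Inter>i\<in>I. f i)" by blast
    then have "k \<le> dim (V \<inter> (\<Inter>i\<in>I. lineality (f i)))"
      using f(1) cc rainbow[of f] by (intro contains_flat_lineality V) auto
    then show False using dim_g f(2) cardI assms(2,3) by simp
  qed
  then obtain J where J: "J \<subseteq> I" and dimM: "d < dim (M J) + card J" by blast
  have M: "subspace (M J)" "M J \<subseteq> V"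
    unfolding M_def
    by (auto intro!: subspace_inter V subspace_Inter simp: subspace_lineality)
  \<comment> \<open>The orthogonal complement of \<open>M J\<close> in \<open>V\<close> serves as
    the quotient of \<open>V\<close> by \<open>M J\<close>; its dimension
    \<open>d - dim (M J)\<close> is less than \<open>card J\<close>.\<close>
  define W where "W = {y \<in> V. \<forall>x\<in>M J. orthogonal x y}"
  have W: "subspace W"
    using subspace_inter[OF V subspace_orthogonal_to_vectors[of "M J"]]
    unfolding W_def by (simp add: Int_def)
  have dimW: "dim W + dim (M J) = d"
    unfolding W_def using dim_subspace_orthogonal_to_vectors[OF M(1) V M(2)] assms(2) by simp
  have inv: "x + v \<in> A" if "v \<in> M J" "i \<in> J" "A \<in> \<F> i" "x \<in> A" for x v i A
    using that unfolding M_def by (auto intro!: lineality_add)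
  have "\<exists>i\<in>J. W \<inter> \<Inter>(\<F> i) \<noteq> {}"
  proof (rule colourful_Helly[OF W])
    show "finite J" using J I(1) by (rule finite_subset)
    show "dim W < card J" using dimW dimM by simp
    show "finite (\<F> i)" if "i \<in> J" for i using that J fin by blast
    show "closed A \<and> convex A" if "i \<in> J" "A \<in> \<F> i" for i A using that J cc by blast
    fix f assume f: "\<And>i. i \<in> J \<Longrightarrow> f i \<in> \<F> i"
    \<comment> \<open>The hypothesis speaks of choices on all of \<open>I\<close>, so the choice on
      \<open>J\<close> is completed by arbitrary members.\<close>
    let ?f = "\<lambda>i. if i \<in> J then f i else \<phi> i"
    have f': "?f i \<in> \<F> i" if "i \<in> I" for i using f \<phi> that by simp
    have "contains_flat k (\<Inter>i\<in>I. ?f i)" by (rule rainbow) (rule f')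
    then obtain L where L: "aff_dim L = int k" "L \<subseteq> (\<Inter>i\<in>I. ?f i)"
      unfolding contains_flat_def flat_def by blast
    then have "L \<noteq> {}" by auto
    then obtain x where x: "\<And>i. i \<in> I \<Longrightarrow> x \<in> ?f i" using L(2) by blast
    have xV: "x \<in> V" using I(2) x f' cc by blast
    \<comment> \<open>Projecting \<open>x\<close> onto \<open>W\<close> moves it by a vector of
      \<open>M J\<close>, which keeps it in every \<open>f i\<close> with
      \<open>i \<in> J\<close>.\<close>
    obtain m w where mw: "m \<in> span (M J)" "\<And>v. v \<in> span (M J) \<Longrightarrow> orthogonal w v" "x = m + w"
      using orthogonal_subspace_decomp_exists by blast
    have m: "m \<in> M J" using mw(1) M(1) by (simp add: span_eq_iff[THEN iffD2])
    have w: "w = x + - m" using mw(3) by simp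
    have "w \<in> V" using xV m M(2) V mw(3) by (metis add_diff_cancel_left' subsetD subspace_diff)
    then have "w \<in> W" unfolding W_def using mw(2) by (auto simp: orthogonal_commute span_base)
    moreover have "w \<in> f i" if "i \<in> J" for i
      unfolding w using that f x[of i] J m M(1) by (intro inv[of _ i]) (auto simp: subspace_neg)
    ultimately show "W \<inter> (\<Inter>i\<in>J. f i) \<noteq> {}" by blast
  qed
  then obtain i y where i: "i \<in> J" and y: "y \<in> W" "\<And>A. A \<in> \<F> i \<Longrightarrow> y \<in> A" by blast
  have "card J \<le> d - k + 1" using card_mono[OF I(1) J] cardI by simp
  then have "k \<le> dim (M J)" using dimM assms(3) by linarith
  then have "contains_flat k (inter_within V (\<F> i))"
    unfolding inter_within_def
  proof (rule contains_flat_translate[OF M(1), of _ y])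
    fix v assume v: "v \<in> M J"
    have "y + v \<in> V" using y(1) v M(2) V unfolding W_def by (auto intro: subspace_add)
    then show "y + v \<in> V \<inter> \<Inter>(\<F> i)" using inv[OF v i] y(2) by blast
  qed
  then show ?thesis using i J unfolding I_def by blast
qed

end
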